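(* Let $d\ge5$ and let $q_1,\ldots,q_d$ be real numbers with $|q_i|\ge e^e$, of which $r\ge1$ are positive and $s\ge1$ negative, $r+s=d$. Let $P$, $q_0$, $q$, $|Q|$, $S_j$, $u$ be as defined below, and let $\pi$ be any permutation of $\{1,\ldots,d\}$. Define $$\mathcal J = \{\alpha\in(0,\infty) : (8dP q_0^{1/2})^{-1} < \alpha < u(P)\},$$ $$\mathcal J_\pi = \{\alpha\in\mathcal J : |q_{\pi(1)}|^{1/2}|S_{\pi(1)}(\alpha)| \le \cdots \le |q_{\pi(d)}|^{1/2}|S_{\pi(d)}(\alpha)|\},$$ $$\mathcal F = \{\alpha\in\mathcal J_\pi : |q_{\pi(i)}|^{1/2}|S_{\pi(i)}(\alpha)| > P\,(u(P)^2 q)^{-1/\min\{i,d-4\}} \text{ for all } i=1,\ldots,d\}.$$ Then $$\int_{\mathcal J_\pi\setminus\mathcal F} |S_1(\alpha)\cdots S_d(\alpha)|\,\mathrm{d}\alpha \le C\,|Q|^{-1/2} P^{d-2}(\log P)^{-1},$$ where $C$ depends only on $d$.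
   Context: Notation: $e(x)=\exp(2\pi i x)$; $q_0 = \min_j|q_j|$, $q = \max_j|q_j|$, $|Q| = \prod_{j=1}^d|q_j|$; $u(P) = (\log(P+e))^2$; $S_j(\alpha) = \sum_{m\in\mathbb{Z},\ P < |q_j|^{1/2} m < 2dP} e(\alpha q_j m^2)$. The parameter $P$ is $P = \exp\{(1 + \tfrac{10 d^2}{\log\log H})\log H\}$ with $H = C_d\, q^{\frac12+\beta}$, $C_d\ge1$ a constant depending on $d$, and $\beta$ given, with $r'=\max(r,s)$, $s'=\min(r,s)$, by $\beta = \frac{r'}{2s'}$ if $r'\ge s'+3$, $\beta=\frac{s'+2}{2(s'-1)}$ if $r'\in\{s'+1,s'+2\}$, $\beta = \frac{s'+1}{2(s'-2)}$ if $r'=s'$. *)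

theory Defs
  imports "HOL-Analysis.Analysis"
begin

definition ee :: "real \<Rightarrow> complex" where
  "ee x = exp (2 * of_real pi * \<i> * of_real x)"

definition upar :: "real \<Rightarrow> real" where
  "upar P = (ln (P + exp 1))\<^sup>2"

definition Ssum :: "nat \<Rightarrow> real \<Rightarrow> real \<Rightarrow> real \<Rightarrow> complex" where
  "Ssum d P qj \<alpha> =
     (\<Sum>m \<in> {m::int. P < sqrt \<bar>qj\<bar> * of_int m \<and> sqrt \<bar>qj\<bar> * of_int m < 2 * real d * P}.
        ee (\<alpha> * qj * (of_int m)\<^sup>2))"

definition betapar :: "nat \<Rightarrow> nat \<Rightarrow> real" where
  "betapar r s =
     (let r' = max r s; s' = min r s in
      if r' \<ge> s' + 3 then real r' / (2 * real s')
      else if r' = s' + 1 \<or> r' = s' + 2 then (real s' + 2) / (2 * (real s' - 1))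
      else (real s' + 1) / (2 * (real s' - 2)))"

definition Hpar :: "real \<Rightarrow> real \<Rightarrow> real \<Rightarrow> real" where
  "Hpar Cd qmax \<beta> = Cd * qmax powr (1/2 + \<beta>)"

definition Ppar :: "nat \<Rightarrow> real \<Rightarrow> real" where
  "Ppar d H = exp ((1 + 10 * (real d)\<^sup>2 / ln (ln H)) * ln H)"

end

(*
  Off F some weighted sum A_pi(i) = |q_pi(i)|^(1/2) |S_pi(i)| is at most
  T = P (u(P)^2 q)^(-1/m) with m = min(i, d-4).  As the A_pi(k) increase with k, the
  m smallest are at most T, the next d-4-m at most the trivial bound 2dP, and the four
  largest at most the largest one.  Hence, pointwise on J_pi - F,
    |S_1 ... S_d| <= |Q|^(-1/2) (2dP)^(d-4) (u(P)^2 q)^(-1) sum_j |q_j|^2 |S_j|^4,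
  and it remains to bound fourth moments.  Expanding |S_j|^4 and integrating over
  [0, u(P)], a pair of solutions of x1^2 + x2^2 = v, x3^2 + x4^2 = w contributes at most
  u(P) if v = w and 1/(2 pi |q_j| |v - w|) otherwise; grouping equal values bounds the
  total by (u(P) + harmonic sum / |q_j|) times the number of solutions of
  x1^2 + x2^2 = x3^2 + x4^2 in a box of side X ~ dP |q_j|^(-1/2).  That number is
  O(X^2 log X): off the diagonal x1 = x3 a solution is determined by (a, b, g, h) with
  x1 - x3 = g a, x4 - x2 = g b, x1 + x3 = h b, x4 + x2 = h a.  So the fourth moment of
  |q_j|^(1/2) S_j is O(u(P) |q_j| P^2 log P), the integral is
  O(|Q|^(-1/2) P^(d-2) log P / u(P)), and u(P) >= (log P)^2 finishes the proof.
*)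

theory Submission
  imports Defs
begin

section \<open>Harmonic sums\<close>

lemma exp_one_leD:
  fixes x :: real
  assumes "exp 1 \<le> x"
  shows "0 < x" and "1 \<le> ln x"
proof -
  show "0 < x" using assms exp_gt_zero by (blast intro: less_le_trans)
  then show "1 \<le> ln x" using assms by (simp add: ln_ge_iff)
qed

lemma harm_le_one_plus_ln:
  assumes "n > 0"
  shows "harm n \<le> 1 + ln (real n)"
proof -
  obtain m where n: "n = Suc m" using assms gr0_implies_Suc by blast
  have "harm (Suc m) - ln (real (Suc m)) \<le> harm (Suc 0) - ln (real (Suc 0))"
    using decseq_harm_diff_ln unfolding decseq_def by (metis le0)
  then show ?thesis unfolding n by (simp add: harm_def)
qed

lemma harm_le_of_le_mult_power:
  fixes a P :: real
  assumes n: "real n \<le> a * P ^ k" and a: "a \<ge> 1" and P: "P \<ge> exp 1"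
  shows "harm n \<le> (1 + ln a + real k) * ln P"
proof (cases "n = 0")
  case True
  then show ?thesis using a exp_one_leD(2)[OF P] by (simp add: harm_def)
next
  case False
  note P0 = exp_one_leD(1)[OF P] and lP = exp_one_leD(2)[OF P]
  have "harm n \<le> 1 + ln (real n)" using False by (simp add: harm_le_one_plus_ln)
  also have "ln (real n) \<le> ln (a * P ^ k)" using n False by (intro ln_mono) auto
  also have "ln (a * P ^ k) = ln a + real k * ln P" using a P0 by (simp add: ln_mult ln_realpow)
  also have "1 + (ln a + real k * ln P) \<le> (1 + ln a + real k) * ln P"
    using a lP mult_left_mono[OF lP, of "1 + ln a"] by (simp add: algebra_simps)
  finally show ?thesis by simp
qed

lemma sum_int_inverse_eq_harm: "(\<Sum>n\<in>{1..int N}. 1 / real_of_int n) = harm N"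
proof -
  have "(\<Sum>n\<in>{1..int N}. 1 / real_of_int n) = (\<Sum>n\<in>int ` {1..N}. 1 / real_of_int n)"
    using image_int_atLeastAtMost[of 1 N] by simp
  also have "\<dots> = harm N" by (subst sum.reindex) (auto simp: harm_def inverse_eq_divide)
  finally show ?thesis .
qed

lemma sum_punctured_interval_abs:
  fixes f :: "int \<Rightarrow> 'a::semiring_1"
  shows "(\<Sum>n\<in>{-Y..Y} - {0}. f \<bar>n\<bar>) = 2 * (\<Sum>n\<in>{1..Y}. f n)"
proof -
  have split: "{-Y..Y} - {0} = {1..Y} \<union> uminus ` {1..Y}" by auto
  have "(\<Sum>n\<in>{-Y..Y} - {0}. f \<bar>n\<bar>) = (\<Sum>n\<in>{1..Y}. f \<bar>n\<bar>) + (\<Sum>n\<in>uminus ` {1..Y}. f \<bar>n\<bar>)"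
    unfolding split by (rule sum.union_disjoint) auto
  also have "(\<Sum>n\<in>uminus ` {1..Y}. f \<bar>n\<bar>) = (\<Sum>n\<in>{1..Y}. f \<bar>n\<bar>)"
    by (subst sum.reindex) (auto simp: inj_on_def)
  also have "(\<Sum>n\<in>{1..Y}. f \<bar>n\<bar>) = (\<Sum>n\<in>{1..Y}. f n)" by (rule sum.cong) auto
  finally show ?thesis by (simp add: mult_2)
qed

lemma sum_inverse_square_max_le:
  fixes X :: int
  shows "(\<Sum>x\<in>{1..X}. \<Sum>y\<in>{1..X}. 1 / (real_of_int (max x y))\<^sup>2) \<le> 2 * harm (nat X)"
proof -
  define f where "f x y = (if y \<le> x then 1 / (real_of_int x)\<^sup>2 else 0)" for x y :: int
  have max_le: "1 / (real_of_int (max x y))\<^sup>2 \<le> f x y + f y x" for x y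
    by (auto simp: f_def max_def)
  have row: "(\<Sum>y\<in>{1..X}. f x y) = 1 / real_of_int x" if "x \<in> {1..X}" for x
  proof -
    have "(\<Sum>y\<in>{1..X}. f x y) = (\<Sum>y\<in>{1..x}. 1 / (real_of_int x)\<^sup>2)"
      using that by (intro sum.mono_neutral_cong_right) (auto simp: f_def)
    also have "\<dots> = 1 / real_of_int x" using that by (simp add: power2_eq_square)
    finally show ?thesis .
  qed
  have "(\<Sum>x\<in>{1..X}. \<Sum>y\<in>{1..X}. 1 / (real_of_int (max x y))\<^sup>2)
      \<le> (\<Sum>x\<in>{1..X}. \<Sum>y\<in>{1..X}. f x y + f y x)"
    by (intro sum_mono max_le)
  also have "\<dots> = (\<Sum>x\<in>{1..X}. \<Sum>y\<in>{1..X}. f x y) + (\<Sum>x\<in>{1..X}. \<Sum>y\<in>{1..X}. f y x)"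
    by (simp add: sum.distrib)
  also have "(\<Sum>x\<in>{1..X}. \<Sum>y\<in>{1..X}. f y x) = (\<Sum>x\<in>{1..X}. \<Sum>y\<in>{1..X}. f x y)"
    by (rule sum.swap)
  also have "(\<Sum>x\<in>{1..X}. \<Sum>y\<in>{1..X}. f x y) = (\<Sum>x\<in>{1..X}. 1 / real_of_int x)"
    using row by simp
  also have "(\<Sum>x\<in>{1..X}. 1 / real_of_int x) = harm (nat X)"
    using sum_int_inverse_eq_harm[of "nat X"] by (cases "X \<ge> 0") auto
  finally show ?thesis by simp
qed

section \<open>Quadratic exponential sums and an oscillatory kernel\<close>

lemma ee_add: "ee (x + y) = ee x * ee y"
  unfolding ee_def by (simp add: algebra_simps flip: exp_add)

lemma ee_mult_cnj: "ee x * cnj (ee y) = ee (x - y)"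
  unfolding ee_def by (simp add: exp_cnj flip: exp_add) (simp add: algebra_simps)

lemma Re_ee: "Re (ee x) = cos (2 * pi * x)"
  unfolding ee_def by (simp add: Re_exp mult.commute)

lemma norm_ee: "norm (ee x) = 1"
  unfolding ee_def by simp

definition quad_weyl_sum :: "int set \<Rightarrow> real \<Rightarrow> complex" where
  "quad_weyl_sum M \<theta> = (\<Sum>m\<in>M. ee (\<theta> * (of_int m)\<^sup>2))"

definition sum_sq :: "int \<times> int \<Rightarrow> int" where
  "sum_sq p = (fst p)\<^sup>2 + (snd p)\<^sup>2"

lemma norm_quad_weyl_sum_le_card: "norm (quad_weyl_sum M \<theta>) \<le> card M"
  unfolding quad_weyl_sum_def using norm_sum[of "\<lambda>m. ee (\<theta> * (of_int m)\<^sup>2)" M] by (simp add: norm_ee)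

lemma continuous_on_quad_weyl_sum: "continuous_on S (\<lambda>a. quad_weyl_sum M (a * c))"
  unfolding quad_weyl_sum_def ee_def by (intro continuous_intros)

lemma norm_quad_weyl_sum_power4:
  "norm (quad_weyl_sum M \<theta>) ^ 4 =
     (\<Sum>p\<in>M \<times> M. \<Sum>p'\<in>M \<times> M. cos (2 * pi * \<theta> * of_int (sum_sq p - sum_sq p')))"
proof -
  define T where "T = quad_weyl_sum M \<theta>"
  have T2: "T\<^sup>2 = (\<Sum>p\<in>M \<times> M. ee (\<theta> * of_int (sum_sq p)))"
    unfolding T_def quad_weyl_sum_def power2_eq_square[of "sum _ _"] sum_product sum.cartesian_product
    by (rule sum.cong) (auto simp: sum_sq_def ee_add[symmetric] algebra_simps)
  have "complex_of_real (norm T ^ 4) = of_real ((norm (T\<^sup>2))\<^sup>2)"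
    by (simp add: norm_power flip: power_mult)
  also have "\<dots> = T\<^sup>2 * cnj (T\<^sup>2)" by (rule complex_norm_square)
  also have "\<dots> = (\<Sum>p\<in>M \<times> M. \<Sum>p'\<in>M \<times> M. ee (\<theta> * of_int (sum_sq p) - \<theta> * of_int (sum_sq p')))"
    unfolding T2 cnj_sum sum_product by (simp add: ee_mult_cnj)
  finally have "norm T ^ 4 = Re \<dots>" by (metis Re_complex_of_real)
  then show ?thesis unfolding T_def by (simp add: Re_ee algebra_simps)
qed

lemma has_integral_cos_mult:
  fixes b U :: real
  assumes "U \<ge> 0"
  shows "((\<lambda>x. cos (b * x)) has_integral (if b = 0 then U else sin (b * U) / b)) {0..U}"
proof (cases "b = 0")
  case True
  then show ?thesis using has_integral_const_real[of "1::real" 0 U] assms by simp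
next
  case False
  have "((\<lambda>x. sin (b * x) / b) has_vector_derivative cos (b * x)) (at x within {0..U})" for x
    using False by (auto intro!: derivative_eq_intros simp flip: has_real_derivative_iff_has_vector_derivative)
  then have "((\<lambda>x. cos (b * x)) has_integral (sin (b * U) / b - sin (b * 0) / b)) {0..U}"
    using assms by (intro fundamental_theorem_of_calculus) auto
  then show ?thesis using False by simp
qed

definition cos_kernel :: "real \<Rightarrow> real \<Rightarrow> int \<Rightarrow> real" where
  "cos_kernel U c n = (if n = 0 then U else 1 / (2 * pi * \<bar>c\<bar> * \<bar>real_of_int n\<bar>))"

lemma integral_cos_le_cos_kernel:
  assumes "U \<ge> 0" and "c \<noteq> 0"
  shows "integral {0..U} (\<lambda>x. cos (2 * pi * c * of_int n * x)) \<le> cos_kernel U c n"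
proof (cases "n = 0")
  case False
  define b where "b = 2 * pi * c * of_int n"
  have b: "b \<noteq> 0" "\<bar>b\<bar> = 2 * pi * \<bar>c\<bar> * \<bar>real_of_int n\<bar>"
    using False assms(2) by (auto simp: b_def abs_mult)
  have "integral {0..U} (\<lambda>x. cos (b * x)) = sin (b * U) / b"
    using has_integral_cos_mult[OF assms(1), of b] b by (simp add: integral_unique)
  also have "\<dots> \<le> \<bar>sin (b * U)\<bar> / \<bar>b\<bar>" using abs_ge_self[of "sin (b * U) / b"] by simp
  also have "\<dots> \<le> 1 / \<bar>b\<bar>" using b by (intro divide_right_mono) auto
  finally show ?thesis using False b by (simp add: cos_kernel_def b_def)
qed (use assms(1) has_integral_cos_mult[OF assms(1), of 0] in \<open>simp add: cos_kernel_def integral_unique\<close>)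

lemma sum_cos_kernel_le:
  fixes V :: "int set" and Y v :: int
  assumes V: "V \<subseteq> {0..Y}" and v: "v \<in> V" and c: "c \<noteq> 0"
  shows "(\<Sum>w\<in>V. cos_kernel U c (v - w)) \<le> U + harm (nat Y) / (pi * \<bar>c\<bar>)"
proof -
  have finV: "finite V" using V finite_subset by blast
  define g where "g n = 1 / (2 * pi * \<bar>c\<bar> * real_of_int n)" for n :: int
  have "(\<Sum>w\<in>V. cos_kernel U c (v - w)) = cos_kernel U c (v - v) + (\<Sum>w\<in>V - {v}. cos_kernel U c (v - w))"
    by (rule sum.remove[OF finV v])
  also have "(\<Sum>w\<in>V - {v}. cos_kernel U c (v - w)) = (\<Sum>w\<in>V - {v}. g \<bar>v - w\<bar>)"
    by (rule sum.cong) (auto simp: cos_kernel_def g_def)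
  also have "(\<Sum>w\<in>V - {v}. g \<bar>v - w\<bar>) = (\<Sum>n\<in>(\<lambda>w. v - w) ` (V - {v}). g \<bar>n\<bar>)"
    by (subst sum.reindex) (auto simp: inj_on_def)
  also have "\<dots> \<le> (\<Sum>n\<in>{-Y..Y} - {0}. g \<bar>n\<bar>)"
    using v c by (intro sum_mono2) (auto simp: g_def dest!: subsetD[OF V])
  also have "\<dots> = 2 * (\<Sum>n\<in>{1..Y}. g n)"
    by (rule sum_punctured_interval_abs)
  also have "(\<Sum>n\<in>{1..Y}. g n) = (\<Sum>n\<in>{1..Y}. 1 / real_of_int n) / (2 * pi * \<bar>c\<bar>)"
    by (simp add: g_def sum_divide_distrib mult.commute)
  also have "(\<Sum>n\<in>{1..Y}. 1 / real_of_int n) = harm (nat Y)"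
    using sum_int_inverse_eq_harm[of "nat Y"] V v by auto
  finally show ?thesis using c by (simp add: cos_kernel_def)
qed

lemma sum_comp_eq_sum_fibres:
  fixes f :: "'b \<Rightarrow> 'c::semiring_1"
  assumes "finite A"
  shows "(\<Sum>a\<in>A. f (s a)) = (\<Sum>v\<in>s ` A. of_nat (card {a\<in>A. s a = v}) * f v)"
proof -
  have "(\<Sum>a\<in>A. f (s a)) = (\<Sum>v\<in>s ` A. \<Sum>a\<in>{a\<in>A. s a = v}. f (s a))"
    using assms by (rule sum.image_gen)
  also have "\<dots> = (\<Sum>v\<in>s ` A. of_nat (card {a\<in>A. s a = v}) * f v)"
    by (intro sum.cong refl) simp
  finally show ?thesis .
qed

(* Group the terms by the values v = s a with multiplicities r v and use
   r v * r w <= (r v^2 + r w^2) / 2 together with the symmetry of k. *)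
lemma double_sum_kernel_le_collisions:
  fixes s :: "'a \<Rightarrow> 'b::ab_group_add" and k :: "'b \<Rightarrow> real"
  assumes A: "finite A" and k_sym: "\<And>n. k (- n) = k n" and k_nonneg: "\<And>n. 0 \<le> k n"
    and row: "\<And>v. v \<in> s ` A \<Longrightarrow> (\<Sum>w\<in>s ` A. k (v - w)) \<le> K"
  shows "(\<Sum>a\<in>A. \<Sum>b\<in>A. k (s a - s b)) \<le> K * card {(a, b) \<in> A \<times> A. s a = s b}"
proof -
  define V where "V = s ` A"
  define r where "r v = real (card {a\<in>A. s a = v})" for v
  have fibres: "(\<Sum>a\<in>A. f (s a)) = (\<Sum>v\<in>V. r v * f v)" for f :: "'b \<Rightarrow> real"
    unfolding V_def r_def by (rule sum_comp_eq_sum_fibres[OF A])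
  have k_swap: "k (w - v) = k (v - w)" for v w
    using k_sym[of "v - w"] by simp
  have row_fibres: "(\<Sum>b\<in>A. k (x - s b)) = (\<Sum>w\<in>V. r w * k (x - w))" for x
    using fibres[of "\<lambda>w. k (x - w)"] by simp
  have "(\<Sum>a\<in>A. \<Sum>b\<in>A. k (s a - s b)) = (\<Sum>a\<in>A. \<Sum>w\<in>V. r w * k (s a - w))"
    by (simp add: row_fibres)
  also have "\<dots> = (\<Sum>v\<in>V. r v * (\<Sum>w\<in>V. r w * k (v - w)))"
    by (rule fibres)
  also have "\<dots> = (\<Sum>v\<in>V. \<Sum>w\<in>V. r v * r w * k (v - w))"
    by (simp add: sum_distrib_left mult.assoc)
  also have "\<dots> \<le> (\<Sum>v\<in>V. \<Sum>w\<in>V. ((r v)\<^sup>2 + (r w)\<^sup>2) / 2 * k (v - w))"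
  proof (intro sum_mono mult_right_mono k_nonneg)
    fix v w
    show "r v * r w \<le> ((r v)\<^sup>2 + (r w)\<^sup>2) / 2"
      using sum_squares_bound[of "r v" "r w"] by (simp add: power2_eq_square field_simps)
  qed
  also have "\<dots> = (\<Sum>v\<in>V. \<Sum>w\<in>V. (r v)\<^sup>2 * k (v - w))"
  proof -
    have "(\<Sum>v\<in>V. \<Sum>w\<in>V. (r w)\<^sup>2 * k (v - w)) = (\<Sum>v\<in>V. \<Sum>w\<in>V. (r v)\<^sup>2 * k (v - w))"
      by (subst sum.swap) (simp add: k_swap)
    moreover have "(\<Sum>v\<in>V. \<Sum>w\<in>V. ((r v)\<^sup>2 + (r w)\<^sup>2) / 2 * k (v - w))
      = ((\<Sum>v\<in>V. \<Sum>w\<in>V. (r v)\<^sup>2 * k (v - w)) + (\<Sum>v\<in>V. \<Sum>w\<in>V. (r w)\<^sup>2 * k (v - w))) / 2"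
      by (simp add: sum.distrib algebra_simps flip: sum_divide_distrib)
    ultimately show ?thesis by simp
  qed
  also have "\<dots> \<le> (\<Sum>v\<in>V. (r v)\<^sup>2 * K)"
    using row unfolding V_def by (intro sum_mono) (simp add: sum_distrib_left[symmetric] mult_left_mono)
  also have "\<dots> = K * (\<Sum>v\<in>V. r v * r v)"
    by (simp add: sum_distrib_left power2_eq_square mult.commute)
  also have "(\<Sum>v\<in>V. r v * r v) = (\<Sum>a\<in>A. r (s a))"
    using fibres[of r] by simp
  also have "\<dots> = card {(a, b) \<in> A \<times> A. s a = s b}"
  proof -
    have "{(a, b) \<in> A \<times> A. s a = s b} = (SIGMA a:A. {b\<in>A. s b = s a})" by auto
    then have "card {(a, b) \<in> A \<times> A. s a = s b} = (\<Sum>a\<in>A. card {b\<in>A. s b = s a})"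
      using A by simp
    then show ?thesis by (simp add: r_def)
  qed
  finally show ?thesis .
qed

section \<open>Equal sums of two squares\<close>

lemma multiples_le_eq_interval:
  fixes m X :: int
  assumes "m \<ge> 1"
  shows "{g. 1 \<le> g \<and> g * m \<le> X} = {1..X div m}"
proof (intro set_eqI iffI)
  fix g assume g: "g \<in> {g. 1 \<le> g \<and> g * m \<le> X}"
  have "g * m div m \<le> X div m" using g assms by (intro zdiv_mono1) auto
  then show "g \<in> {1..X div m}" using g assms by simp
next
  fix g assume g: "g \<in> {1..X div m}"
  have "g * m \<le> X div m * m" using g assms by (intro mult_right_mono) auto
  also have "\<dots> \<le> X" using assms by (simp add: minus_mod_eq_div_mult [symmetric])
  finally show "g \<in> {g. 1 \<le> g \<and> g * m \<le> X}" using g by simp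
qed

lemma nonzero_multiples_subset:
  fixes m Y :: int
  shows "{h. h \<noteq> 0 \<and> \<bar>h\<bar> * m \<le> Y} \<subseteq> {g. 1 \<le> g \<and> g * m \<le> Y} \<union> uminus ` {g. 1 \<le> g \<and> g * m \<le> Y}"
proof
  fix h assume h: "h \<in> {h. h \<noteq> 0 \<and> \<bar>h\<bar> * m \<le> Y}"
  show "h \<in> {g. 1 \<le> g \<and> g * m \<le> Y} \<union> uminus ` {g. 1 \<le> g \<and> g * m \<le> Y}"
  proof (cases "h > 0")
    case False
    then have "- h \<in> {g. 1 \<le> g \<and> g * m \<le> Y}" using h by auto
    then show ?thesis by (auto intro: image_eqI[of h uminus "- h"])
  qed (use h in auto)
qed

lemma card_multiples_le:
  fixes m X :: int
  assumes "m \<ge> 1" and "X \<ge> 0"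
  shows "real (card {g. 1 \<le> g \<and> g * m \<le> X}) \<le> X / m"
proof -
  have "real (card {g. 1 \<le> g \<and> g * m \<le> X}) = of_int (X div m)"
    using assms by (simp add: multiples_le_eq_interval pos_imp_zdiv_nonneg_iff)
  also have "\<dots> \<le> X / m" by (rule real_of_int_div4)
  finally show ?thesis .
qed

lemma card_nonzero_multiples_le:
  fixes m Y :: int
  assumes "m \<ge> 1" and "Y \<ge> 0"
  shows "real (card {h. h \<noteq> 0 \<and> \<bar>h\<bar> * m \<le> Y}) \<le> 2 * Y / m"
proof -
  define G where "G = {g. 1 \<le> g \<and> g * m \<le> Y}"
  have G: "finite G" unfolding G_def using assms(1) by (simp add: multiples_le_eq_interval)
  have "card {h. h \<noteq> 0 \<and> \<bar>h\<bar> * m \<le> Y} \<le> card (G \<union> uminus ` G)"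
    using G nonzero_multiples_subset unfolding G_def by (intro card_mono) auto
  also have "\<dots> \<le> card G + card (uminus ` G)" by (rule card_Un_le)
  also have "\<dots> \<le> 2 * card G" using card_image_le[OF G, of uminus] by simp
  finally have "real (card {h. h \<noteq> 0 \<and> \<bar>h\<bar> * m \<le> Y}) \<le> 2 * real (card G)" by linarith
  then show ?thesis using card_multiples_le[OF assms] unfolding G_def by simp
qed

lemma mult_eq_mult_gcd_param:
  fixes \<alpha> \<beta> \<gamma> \<epsilon> :: int
  assumes "\<alpha> \<noteq> 0" and "\<beta> \<noteq> 0" and eq: "\<alpha> * \<beta> = \<gamma> * \<epsilon>"
  defines "g \<equiv> gcd \<alpha> \<gamma>" and "x \<equiv> \<alpha> div gcd \<alpha> \<gamma>" and "y \<equiv> \<gamma> div gcd \<alpha> \<gamma>"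
    and "h \<equiv> \<beta> div (\<gamma> div gcd \<alpha> \<gamma>)"
  shows "1 \<le> g \<and> \<alpha> = g * x \<and> \<gamma> = g * y \<and> \<beta> = h * y \<and> \<epsilon> = h * x"
proof -
  have g: "1 \<le> g" using assms(1) unfolding g_def by (simp add: int_one_le_iff_zero_less)
  have \<alpha>: "\<alpha> = g * x" and \<gamma>: "\<gamma> = g * y" unfolding g_def x_def y_def by simp_all
  have "coprime x y" unfolding x_def y_def using assms(1) by (intro div_gcd_coprime) auto
  moreover have xy: "x * \<beta> = y * \<epsilon>" using eq \<alpha> \<gamma> g by (simp add: algebra_simps)
  then have "y dvd x * \<beta>" by simp
  ultimately have "y dvd \<beta>" by (simp add: coprime_commute coprime_dvd_mult_right_iff)
  then have \<beta>: "\<beta> = h * y" unfolding h_def y_def g_def by simp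
  have "y \<noteq> 0" using \<beta> assms(2) by auto
  then have "\<epsilon> = h * x" using xy \<beta> by (simp add: algebra_simps)
  then show ?thesis using g \<alpha> \<gamma> \<beta> by simp
qed

definition sum_sq_collisions :: "int \<Rightarrow> ((int \<times> int) \<times> (int \<times> int)) set" where
  "sum_sq_collisions X =
     {(a, b). a \<in> {1..X} \<times> {1..X} \<and> b \<in> {1..X} \<times> {1..X} \<and> sum_sq a = sum_sq b}"

(* a1^2 + a2^2 = b1^2 + b2^2 means (a1 - b1)(a1 + b1) = (b2 - a2)(b2 + a2).  Dividing the
   first factors by g = gcd (a1 - b1) (b2 - a2) leaves coprime x, y, which forces
   a1 + b1 = h y and b2 + a2 = h x; the solution is recovered from (x, y, g, h). *)
definition collision_param :: "(int \<times> int) \<times> (int \<times> int) \<Rightarrow> (int \<times> int) \<times> (int \<times> int)" where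
  "collision_param z = (case z of ((a1, a2), (b1, b2)) \<Rightarrow>
     let g = gcd (a1 - b1) (b2 - a2); y = (b2 - a2) div g in (((a1 - b1) div g, y), (g, (a1 + b1) div y)))"

definition collision_params :: "int \<Rightarrow> ((int \<times> int) \<times> (int \<times> int)) set" where
  "collision_params X = (SIGMA (x, y):({-X..X} - {0}) \<times> ({-X..X} - {0}).
     {g. 1 \<le> g \<and> g * max \<bar>x\<bar> \<bar>y\<bar> \<le> X} \<times> {h. h \<noteq> 0 \<and> \<bar>h\<bar> * max \<bar>x\<bar> \<bar>y\<bar> \<le> 2 * X})"

lemma collision_param_eqs:
  fixes a1 a2 b1 b2 :: int
  assumes "a1\<^sup>2 + a2\<^sup>2 = b1\<^sup>2 + b2\<^sup>2" and "a1 \<noteq> b1" and "a1 + b1 \<noteq> 0"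
  obtains x y g h where "collision_param ((a1, a2), (b1, b2)) = ((x, y), (g, h))" and "1 \<le> g"
    and "a1 - b1 = g * x" and "b2 - a2 = g * y" and "a1 + b1 = h * y" and "b2 + a2 = h * x"
proof -
  have "(a1 - b1) * (a1 + b1) = (b2 - a2) * (b2 + a2)"
    using assms(1) by (simp add: algebra_simps power2_eq_square)
  from mult_eq_mult_gcd_param[OF _ assms(3) this] assms(2) show ?thesis
    by (intro that) (auto simp: collision_param_def Let_def)
qed

lemma inj_on_collision_param:
  "inj_on collision_param {((a1, a2), (b1, b2)). a1\<^sup>2 + a2\<^sup>2 = b1\<^sup>2 + b2\<^sup>2 \<and> a1 \<noteq> b1 \<and> a1 + b1 \<noteq> 0}"
  (is "inj_on _ ?S")
proof (rule inj_onI)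
  fix z w assume "z \<in> ?S" "w \<in> ?S" and eq: "collision_param z = collision_param w"
  then obtain a1 a2 b1 b2 a1' a2' b1' b2' where zw: "z = ((a1, a2), (b1, b2))" "w = ((a1', a2'), (b1', b2'))"
    and z: "a1\<^sup>2 + a2\<^sup>2 = b1\<^sup>2 + b2\<^sup>2" "a1 \<noteq> b1" "a1 + b1 \<noteq> 0"
    and w: "a1'\<^sup>2 + a2'\<^sup>2 = b1'\<^sup>2 + b2'\<^sup>2" "a1' \<noteq> b1'" "a1' + b1' \<noteq> 0"
    by auto
  obtain x y g h where p: "collision_param z = ((x, y), (g, h))"
    "a1 - b1 = g * x" "b2 - a2 = g * y" "a1 + b1 = h * y" "b2 + a2 = h * x"
    using collision_param_eqs[OF z] unfolding zw by metis
  obtain x' y' g' h' where p': "collision_param w = ((x', y'), (g', h'))"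
    "a1' - b1' = g' * x'" "b2' - a2' = g' * y'" "a1' + b1' = h' * y'" "b2' + a2' = h' * x'"
    using collision_param_eqs[OF w] unfolding zw by metis
  have "x' = x" "y' = y" "g' = g" "h' = h" using p(1) p'(1) eq by simp_all
  then show "z = w" using p(2-5) p'(2-5) unfolding zw by auto
qed

lemma collision_param_in_params:
  assumes "((a1, a2), (b1, b2)) \<in> sum_sq_collisions X" and "a1 \<noteq> b1"
  shows "collision_param ((a1, a2), (b1, b2)) \<in> collision_params X"
proof -
  have box: "1 \<le> a1" "a1 \<le> X" "1 \<le> a2" "a2 \<le> X" "1 \<le> b1" "b1 \<le> X" "1 \<le> b2" "b2 \<le> X"
    and sq: "a1\<^sup>2 + a2\<^sup>2 = b1\<^sup>2 + b2\<^sup>2"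
    using assms(1) by (auto simp: sum_sq_collisions_def sum_sq_def)
  moreover have "a1 + b1 \<noteq> 0" using box by simp
  ultimately obtain x y g h where p: "collision_param ((a1, a2), (b1, b2)) = ((x, y), (g, h))" "1 \<le> g"
    "a1 - b1 = g * x" "b2 - a2 = g * y" "a1 + b1 = h * y" "b2 + a2 = h * x"
    using collision_param_eqs assms(2) by metis
  have bounds: "g * \<bar>x\<bar> \<le> X" "g * \<bar>y\<bar> \<le> X" "\<bar>h\<bar> * \<bar>x\<bar> \<le> 2 * X" "\<bar>h\<bar> * \<bar>y\<bar> \<le> 2 * X"
    using p box by (simp_all flip: abs_mult add: abs_le_iff)
  have "\<bar>x\<bar> \<le> g * \<bar>x\<bar>" "\<bar>y\<bar> \<le> g * \<bar>y\<bar>" using p(2) by (simp_all add: mult_le_cancel_right1)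
  then have "\<bar>x\<bar> \<le> X" "\<bar>y\<bar> \<le> X" using bounds by linarith+
  moreover have "x \<noteq> 0" "y \<noteq> 0" "h \<noteq> 0" using p(3,5) assms(2) box by auto
  ultimately show ?thesis using p(2) bounds unfolding p(1) collision_params_def by (auto simp: max_def)
qed

lemma finite_collision_params: "finite (collision_params X)"
proof (rule finite_subset)
  show "collision_params X \<subseteq> ({-X..X} \<times> {-X..X}) \<times> ({1..X} \<times> {-2 * X..2 * X})"
  proof
    fix z assume z: "z \<in> collision_params X"
    obtain x y g h where zz: "z = ((x, y), (g, h))" by (metis prod.collapse)
    have p: "1 \<le> max \<bar>x\<bar> \<bar>y\<bar>" "\<bar>x\<bar> \<le> X" "\<bar>y\<bar> \<le> X" "1 \<le> g"
      "g * max \<bar>x\<bar> \<bar>y\<bar> \<le> X" "\<bar>h\<bar> * max \<bar>x\<bar> \<bar>y\<bar> \<le> 2 * X"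
      using z unfolding zz by (auto simp: collision_params_def le_max_iff_disj)
    then have "g \<le> g * max \<bar>x\<bar> \<bar>y\<bar>" "\<bar>h\<bar> \<le> \<bar>h\<bar> * max \<bar>x\<bar> \<bar>y\<bar>"
      by (simp_all add: mult_le_cancel_left1)
    then have "g \<le> X" "\<bar>h\<bar> \<le> 2 * X" using p by linarith+
    then show "z \<in> ({-X..X} \<times> {-X..X}) \<times> ({1..X} \<times> {-2 * X..2 * X})"
      using p unfolding zz by (auto simp: abs_le_iff)
  qed
qed simp

lemma card_collision_params:
  assumes X: "X \<ge> 0"
  shows "real (card (collision_params X)) \<le> 32 * (real_of_int X)\<^sup>2 * harm (nat X)"
proof -
  define Z where "Z = {-X..X} - {0}"
  define m where "m x y = max \<bar>x\<bar> \<bar>y\<bar>" for x y :: int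
  define G where "G x y = {g. 1 \<le> g \<and> g * m x y \<le> X}" for x y
  define H where "H x y = {h. h \<noteq> 0 \<and> \<bar>h\<bar> * m x y \<le> 2 * X}" for x y
  have m1: "1 \<le> m x y" if "x \<in> Z" for x y using that by (auto simp: Z_def m_def)
  have X_div_m: "0 \<le> X / m x y" if "x \<in> Z" for x y using m1[of x y] that X by simp
  have fin: "finite (G x y \<times> H x y)" if "x \<in> Z" for x y
  proof -
    have fin_pos: "finite {g. 1 \<le> g \<and> g * m x y \<le> 2 * X}"
      using m1[OF that] by (simp add: multiples_le_eq_interval)
    have "finite (H x y)"
      unfolding H_def by (rule finite_subset[OF nonzero_multiples_subset]) (use fin_pos in simp)
    then show ?thesis using m1[OF that] by (simp add: G_def multiples_le_eq_interval)
  qed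
  have "collision_params X = (SIGMA (x, y):Z \<times> Z. G x y \<times> H x y)"
    by (simp add: collision_params_def Z_def G_def H_def m_def)
  then have "real (card (collision_params X)) = (\<Sum>x\<in>Z. \<Sum>y\<in>Z. real (card (G x y)) * real (card (H x y)))"
    using fin by (simp add: Z_def sum.cartesian_product card_cartesian_product split_def)
  also have "\<dots> \<le> (\<Sum>x\<in>Z. \<Sum>y\<in>Z. (X / m x y) * (4 * X / m x y))"
    using m1 X X_div_m unfolding G_def H_def
    by (intro sum_mono mult_mono card_multiples_le) (auto intro: card_nonzero_multiples_le[THEN order_trans])
  also have "\<dots> = 4 * (real_of_int X)\<^sup>2 * (\<Sum>x\<in>Z. \<Sum>y\<in>Z. 1 / (real_of_int (max \<bar>x\<bar> \<bar>y\<bar>))\<^sup>2)"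
    by (simp add: m_def sum_distrib_left power2_eq_square mult_ac)
  also have "(\<Sum>x\<in>Z. \<Sum>y\<in>Z. 1 / (real_of_int (max \<bar>x\<bar> \<bar>y\<bar>))\<^sup>2)
      = 4 * (\<Sum>x\<in>{1..X}. \<Sum>y\<in>{1..X}. 1 / (real_of_int (max x y))\<^sup>2)"
  proof -
    have "(\<Sum>y\<in>Z. 1 / (real_of_int (max \<bar>x\<bar> \<bar>y\<bar>))\<^sup>2) = 2 * (\<Sum>y\<in>{1..X}. 1 / (real_of_int (max \<bar>x\<bar> y))\<^sup>2)"
      for x unfolding Z_def by (rule sum_punctured_interval_abs)
    then show ?thesis
      using sum_punctured_interval_abs[of "\<lambda>t. 2 * (\<Sum>y\<in>{1..X}. 1 / (real_of_int (max t y))\<^sup>2)" X]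
      by (simp add: Z_def sum_distrib_left)
  qed
  also have "4 * (real_of_int X)\<^sup>2 * \<dots> \<le> 4 * (real_of_int X)\<^sup>2 * (4 * (2 * harm (nat X)))"
    by (intro mult_left_mono sum_inverse_square_max_le) simp_all
  finally show ?thesis by simp
qed

lemma finite_sum_sq_collisions: "finite (sum_sq_collisions X)"
  by (rule finite_subset[of _ "({1..X} \<times> {1..X}) \<times> ({1..X} \<times> {1..X})"])
    (auto simp: sum_sq_collisions_def)

lemma card_sum_sq_collisions:
  assumes X: "X \<ge> 0"
  shows "real (card (sum_sq_collisions X)) \<le> (real_of_int X)\<^sup>2 * (1 + 32 * harm (nat X))"
proof -
  define B where "B = {1..X} \<times> {1..X}"
  define D where "D = {z \<in> sum_sq_collisions X. fst (fst z) = fst (snd z)}"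
  define E where "E = {z \<in> sum_sq_collisions X. fst (fst z) \<noteq> fst (snd z)}"
  have "D \<subseteq> (\<lambda>a. (a, a)) ` B"
  proof
    fix z assume "z \<in> D"
    then obtain a1 a2 b2 where z: "z = ((a1, a2), (a1, b2))" "(a1, a2) \<in> B" "1 \<le> b2" "a2\<^sup>2 = b2\<^sup>2"
      by (auto simp: D_def B_def sum_sq_collisions_def sum_sq_def)
    then have "a2 = b2" by (auto simp: B_def)
    then show "z \<in> (\<lambda>a. (a, a)) ` B" using z by auto
  qed
  then have "card D \<le> card B"
    using card_image_le[of B "\<lambda>a. (a, a)"] card_mono[of "(\<lambda>a. (a, a)) ` B" D] by (simp add: B_def)
  moreover have "card E \<le> card (collision_params X)"
  proof (rule card_inj_on_le)
    show "inj_on collision_param E"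
      by (rule inj_on_subset[OF inj_on_collision_param])
        (auto simp: E_def sum_sq_collisions_def sum_sq_def)
    show "collision_param ` E \<subseteq> collision_params X"
      using collision_param_in_params by (auto simp: E_def)
    show "finite (collision_params X)"
      by (rule finite_collision_params)
  qed
  moreover have "card (sum_sq_collisions X) \<le> card D + card E"
    using finite_sum_sq_collisions[of X]
    by (intro order_trans[OF card_mono card_Un_le]) (auto simp: D_def E_def)
  ultimately have "real (card (sum_sq_collisions X)) \<le> real (card B) + real (card (collision_params X))"
    by linarith
  also have "real (card B) = (real_of_int X)\<^sup>2" using X by (simp add: B_def power2_eq_square)
  finally show ?thesis using card_collision_params[OF X] by (simp add: algebra_simps)
qed

section \<open>Fourth moments of the sums S_j\<close>

lemma integral_quad_weyl_sum_power4_le: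
  fixes M :: "int set" and c U :: real and X :: int
  assumes M: "M \<subseteq> {1..X}" and X: "X \<ge> 0" and c: "c \<noteq> 0" and U: "U \<ge> 0"
  shows "integral {0..U} (\<lambda>a. norm (quad_weyl_sum M (a * c)) ^ 4)
    \<le> (U + harm (nat (2 * X\<^sup>2)) / (pi * \<bar>c\<bar>)) * ((real_of_int X)\<^sup>2 * (1 + 32 * harm (nat X)))"
proof -
  define A where "A = M \<times> M"
  define K where "K = U + harm (nat (2 * X\<^sup>2)) / (pi * \<bar>c\<bar>)"
  have A: "finite A" using M by (auto simp: A_def intro: finite_subset)
  have K: "K \<ge> 0" using U by (simp add: K_def harm_nonneg)
  have sum_sq_A: "sum_sq ` A \<subseteq> {0..2 * X\<^sup>2}"
  proof
    fix v assume "v \<in> sum_sq ` A"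
    then obtain m1 m2 where m: "m1 \<in> M" "m2 \<in> M" "v = m1\<^sup>2 + m2\<^sup>2"
      by (auto simp: A_def sum_sq_def)
    then have "m1\<^sup>2 \<le> X\<^sup>2" "m2\<^sup>2 \<le> X\<^sup>2" using M by (auto intro!: power_mono)
    then show "v \<in> {0..2 * X\<^sup>2}" using m by simp
  qed
  have collisions_A: "card {(p, p') \<in> A \<times> A. sum_sq p = sum_sq p'} \<le> card (sum_sq_collisions X)"
    using M by (intro card_mono finite_sum_sq_collisions) (auto simp: A_def sum_sq_collisions_def)
  have cos_integrable: "(\<lambda>a. cos (2 * pi * c * of_int n * a)) integrable_on {0..U}" for n :: int
    by (intro integrable_continuous_interval continuous_intros)
  have "integral {0..U} (\<lambda>a. norm (quad_weyl_sum M (a * c)) ^ 4)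
      = integral {0..U} (\<lambda>a. \<Sum>p\<in>A. \<Sum>p'\<in>A. cos (2 * pi * c * of_int (sum_sq p - sum_sq p') * a))"
    by (simp add: norm_quad_weyl_sum_power4 A_def mult_ac)
  also have "\<dots> = (\<Sum>p\<in>A. \<Sum>p'\<in>A. integral {0..U} (\<lambda>a. cos (2 * pi * c * of_int (sum_sq p - sum_sq p') * a)))"
    by (simp only: integral_sum[OF A] integrable_sum[OF A] cos_integrable)
  also have "\<dots> \<le> (\<Sum>p\<in>A. \<Sum>p'\<in>A. cos_kernel U c (sum_sq p - sum_sq p'))"
    using U c by (intro sum_mono integral_cos_le_cos_kernel)
  also have "\<dots> \<le> K * card {(p, p') \<in> A \<times> A. sum_sq p = sum_sq p'}"
  proof (rule double_sum_kernel_le_collisions[OF A])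
    show "cos_kernel U c (- n) = cos_kernel U c n" "0 \<le> cos_kernel U c n" for n
      using U by (simp_all add: cos_kernel_def)
    show "(\<Sum>w\<in>sum_sq ` A. cos_kernel U c (v - w)) \<le> K" if "v \<in> sum_sq ` A" for v
      unfolding K_def using sum_sq_A that c by (rule sum_cos_kernel_le)
  qed
  also have "\<dots> \<le> K * card (sum_sq_collisions X)"
    using K collisions_A by (intro mult_left_mono) simp_all
  also have "\<dots> \<le> K * ((real_of_int X)\<^sup>2 * (1 + 32 * harm (nat X)))"
    using K by (intro mult_left_mono card_sum_sq_collisions X)
  finally show ?thesis unfolding K_def .
qed

definition weyl_window :: "nat \<Rightarrow> real \<Rightarrow> real \<Rightarrow> int set" where
  "weyl_window d P qj = {m. P < sqrt \<bar>qj\<bar> * of_int m \<and> sqrt \<bar>qj\<bar> * of_int m < 2 * real d * P}"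

lemma Ssum_eq_quad_weyl_sum: "Ssum d P qj \<alpha> = quad_weyl_sum (weyl_window d P qj) (\<alpha> * qj)"
  by (simp add: Ssum_def quad_weyl_sum_def weyl_window_def)

lemma weyl_window_subset:
  assumes "P > 0" and "\<bar>qj\<bar> \<ge> 1"
  shows "weyl_window d P qj \<subseteq> {1..\<lfloor>2 * real d * P / sqrt \<bar>qj\<bar>\<rfloor>}"
proof
  fix m assume "m \<in> weyl_window d P qj"
  then have m: "P < sqrt \<bar>qj\<bar> * of_int m" "sqrt \<bar>qj\<bar> * of_int m < 2 * real d * P"
    by (auto simp: weyl_window_def)
  have "0 < sqrt \<bar>qj\<bar> * of_int m" using m(1) assms(1) by linarith
  then have "m \<ge> 1" using assms(2) by (simp add: zero_less_mult_iff)
  moreover have "of_int m \<le> 2 * real d * P / sqrt \<bar>qj\<bar>"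
    using m(2) assms(2) by (simp add: field_simps)
  ultimately show "m \<in> {1..\<lfloor>2 * real d * P / sqrt \<bar>qj\<bar>\<rfloor>}" by (simp add: le_floor_iff)
qed

lemma Ssum_trivial_bound:
  assumes "P > 0" and "\<bar>qj\<bar> \<ge> 1"
  shows "sqrt \<bar>qj\<bar> * norm (Ssum d P qj \<alpha>) \<le> 2 * real d * P"
proof -
  define X where "X = \<lfloor>2 * real d * P / sqrt \<bar>qj\<bar>\<rfloor>"
  have "norm (Ssum d P qj \<alpha>) \<le> card (weyl_window d P qj)"
    by (simp add: Ssum_eq_quad_weyl_sum norm_quad_weyl_sum_le_card)
  also have "card (weyl_window d P qj) \<le> card {1..X}"
    unfolding X_def using weyl_window_subset[OF assms] by (intro card_mono) auto
  also have "real (card {1..X}) \<le> 2 * real d * P / sqrt \<bar>qj\<bar>"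
    using assms unfolding X_def by simp
  finally show ?thesis using assms(2) by (simp add: field_simps)
qed

(* 132 d^2 c1 (1 + c2), where c1 ln P and c2 ln P bound the harmonic sums up to 2dP and
   up to 8 d^2 P^2 (see weyl_window_length_bounds). *)
definition fourth_moment_const :: "nat \<Rightarrow> real" where
  "fourth_moment_const d = 132 * (real d)\<^sup>2 * (2 + ln (2 * real d)) * (4 + ln (8 * (real d)\<^sup>2))"

lemma fourth_moment_const_nonneg:
  assumes "d \<ge> 1"
  shows "0 \<le> fourth_moment_const d"
proof -
  have "1 \<le> (real d)\<^sup>2" using assms by simp
  then have "1 \<le> 8 * (real d)\<^sup>2" by linarith
  then have "0 \<le> ln (2 * real d)" "0 \<le> ln (8 * (real d)\<^sup>2)" using assms by simp_all
  then show ?thesis by (simp add: fourth_moment_const_def)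
qed

lemma weyl_window_length_bounds:
  fixes X :: int
  assumes d: "d \<ge> 1" and q: "\<bar>qj\<bar> \<ge> 1" and P: "P \<ge> exp 1"
  defines "X \<equiv> \<lfloor>2 * real d * P / sqrt \<bar>qj\<bar>\<rfloor>"
  shows "0 \<le> X" and "(real_of_int X)\<^sup>2 \<le> 4 * (real d)\<^sup>2 * P\<^sup>2 / \<bar>qj\<bar>"
    and "harm (nat X) \<le> (2 + ln (2 * real d)) * ln P"
    and "harm (nat (2 * X\<^sup>2)) \<le> (3 + ln (8 * (real d)\<^sup>2)) * ln P"
proof -
  note P0 = exp_one_leD(1)[OF P]
  show X0: "0 \<le> X" unfolding X_def using P0 q by simp
  have X: "real_of_int X \<le> 2 * real d * P / sqrt \<bar>qj\<bar>" unfolding X_def by simp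
  then have "(real_of_int X)\<^sup>2 \<le> (2 * real d * P / sqrt \<bar>qj\<bar>)\<^sup>2" using X0 by (intro power_mono) auto
  then show "(real_of_int X)\<^sup>2 \<le> 4 * (real d)\<^sup>2 * P\<^sup>2 / \<bar>qj\<bar>"
    using q by (simp add: power_divide power_mult_distrib)
  have "2 * real d * P / sqrt \<bar>qj\<bar> \<le> 2 * real d * P / 1" using q P0 by (intro divide_left_mono) auto
  then have X': "real_of_int X \<le> 2 * real d * P" using X by simp
  then show "harm (nat X) \<le> (2 + ln (2 * real d)) * ln P"
    using harm_le_of_le_mult_power[of "nat X" "2 * real d" P 1] X0 d P by (simp add: add_ac)
  have "(real_of_int X)\<^sup>2 \<le> (2 * real d * P)\<^sup>2" using X0 X' by (intro power_mono) auto
  then have n: "real (nat (2 * X\<^sup>2)) \<le> 8 * (real d)\<^sup>2 * P ^ 2"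
    by (simp add: power_mult_distrib mult_ac)
  have "1 \<le> (real d)\<^sup>2" using d by simp
  then have "1 \<le> 8 * (real d)\<^sup>2" by linarith
  from harm_le_of_le_mult_power[OF n this P]
  show "harm (nat (2 * X\<^sup>2)) \<le> (3 + ln (8 * (real d)\<^sup>2)) * ln P" by simp
qed

lemma integral_Ssum_power4_le:
  assumes d: "d \<ge> 1" and q: "\<bar>qj\<bar> \<ge> 1" and P: "P \<ge> exp 1" and u: "(ln P)\<^sup>2 \<le> upar P"
  shows "integral {0..upar P} (\<lambda>a. \<bar>qj\<bar>\<^sup>2 * norm (Ssum d P qj a) ^ 4)
    \<le> fourth_moment_const d * upar P * \<bar>qj\<bar> * P\<^sup>2 * ln P"
proof -
  define u l X where "u = upar P" and "l = ln P" and "X = \<lfloor>2 * real d * P / sqrt \<bar>qj\<bar>\<rfloor>"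
  define c1 c2 where "c1 = 2 + ln (2 * real d)" and "c2 = 3 + ln (8 * (real d)\<^sup>2)"
  note X = weyl_window_length_bounds[OF d q P, folded X_def c1_def c2_def l_def]
  have l1: "1 \<le> l" unfolding l_def by (rule exp_one_leD(2)[OF P])
  have "l \<le> l * l" using l1 by (simp add: mult_le_cancel_left1)
  then have lu: "l \<le> u" using u unfolding u_def l_def by (simp add: power2_eq_square)
  have "1 \<le> (real d)\<^sup>2" using d by simp
  then have "1 \<le> 8 * (real d)\<^sup>2" by linarith
  then have c: "1 \<le> c1" "0 \<le> c2" using d by (simp_all add: c1_def c2_def)
  have "1 \<le> pi * \<bar>qj\<bar>" using mult_mono[of 1 pi 1 "\<bar>qj\<bar>"] q pi_gt3 by simp
  then have "harm (nat (2 * X\<^sup>2)) / (pi * \<bar>qj\<bar>) \<le> harm (nat (2 * X\<^sup>2)) / 1"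
    by (intro divide_left_mono harm_nonneg) auto
  then have A1: "u + harm (nat (2 * X\<^sup>2)) / (pi * \<bar>qj\<bar>) \<le> (1 + c2) * u"
    using X(4) mult_left_mono[OF lu c(2)] by (simp add: algebra_simps)
  have "1 * 1 \<le> c1 * l" using c(1) l1 by (intro mult_mono) auto
  then have "1 + 32 * harm (nat X) \<le> 33 * c1 * l" using X(3) by simp
  then have A2: "(real_of_int X)\<^sup>2 * (1 + 32 * harm (nat X)) \<le> (4 * (real d)\<^sup>2 * P\<^sup>2 / \<bar>qj\<bar>) * (33 * c1 * l)"
    using X(2) q by (intro mult_mono) (auto simp: harm_nonneg)
  have "integral {0..u} (\<lambda>a. norm (Ssum d P qj a) ^ 4)
      \<le> (u + harm (nat (2 * X\<^sup>2)) / (pi * \<bar>qj\<bar>)) * ((real_of_int X)\<^sup>2 * (1 + 32 * harm (nat X)))"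
    unfolding Ssum_eq_quad_weyl_sum using weyl_window_subset[OF exp_one_leD(1)[OF P] q] X(1) q
    by (intro integral_quad_weyl_sum_power4_le) (auto simp: X_def u_def upar_def)
  also have "\<dots> \<le> ((1 + c2) * u) * ((4 * (real d)\<^sup>2 * P\<^sup>2 / \<bar>qj\<bar>) * (33 * c1 * l))"
    using c lu l1 by (intro mult_mono[OF A1 A2]) (auto simp: harm_nonneg)
  finally have "integral {0..u} (\<lambda>a. \<bar>qj\<bar>\<^sup>2 * norm (Ssum d P qj a) ^ 4)
      \<le> \<bar>qj\<bar>\<^sup>2 * (((1 + c2) * u) * ((4 * (real d)\<^sup>2 * P\<^sup>2 / \<bar>qj\<bar>) * (33 * c1 * l)))"
    unfolding integral_mult_right by (rule mult_left_mono) simp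
  also have "\<dots> = fourth_moment_const d * u * \<bar>qj\<bar> * P\<^sup>2 * l"
  proof -
    have "x\<^sup>2 * (((1 + c2) * u) * ((4 * (real d)\<^sup>2 * P\<^sup>2 / x) * (33 * c1 * l)))
        = fourth_moment_const d * u * x * P\<^sup>2 * l" if "x \<noteq> 0" for x :: real
      using that unfolding fourth_moment_const_def c1_def c2_def by (simp add: field_simps power2_eq_square)
    from this[of "\<bar>qj\<bar>"] q show ?thesis by fastforce
  qed
  finally show ?thesis unfolding u_def l_def by simp
qed

lemma integral_sum_Ssum_power4_le:
  assumes d: "d \<ge> 1" and q: "\<And>j. j \<in> {1..d} \<Longrightarrow> 1 \<le> \<bar>q j\<bar>" and qm: "\<And>j. j \<in> {1..d} \<Longrightarrow> \<bar>q j\<bar> \<le> qm"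
    and P: "P \<ge> exp 1" and u: "(ln P)\<^sup>2 \<le> upar P"
  shows "(\<lambda>a. \<Sum>j\<in>{1..d}. \<bar>q j\<bar>\<^sup>2 * norm (Ssum d P (q j) a) ^ 4) integrable_on {0..upar P}"
    and "integral {0..upar P} (\<lambda>a. \<Sum>j\<in>{1..d}. \<bar>q j\<bar>\<^sup>2 * norm (Ssum d P (q j) a) ^ 4)
      \<le> real d * (fourth_moment_const d * upar P * qm * P\<^sup>2 * ln P)"
proof -
  have int: "(\<lambda>a. \<bar>q j\<bar>\<^sup>2 * norm (Ssum d P (q j) a) ^ 4) integrable_on {0..upar P}" for j
    unfolding Ssum_eq_quad_weyl_sum
    by (intro integrable_continuous_interval continuous_intros continuous_on_quad_weyl_sum)
  then show "(\<lambda>a. \<Sum>j\<in>{1..d}. \<bar>q j\<bar>\<^sup>2 * norm (Ssum d P (q j) a) ^ 4) integrable_on {0..upar P}"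
    by (intro integrable_sum) auto
  have "0 \<le> ln P" using exp_one_leD(2)[OF P] by simp
  have "integral {0..upar P} (\<lambda>a. \<Sum>j\<in>{1..d}. \<bar>q j\<bar>\<^sup>2 * norm (Ssum d P (q j) a) ^ 4)
      = (\<Sum>j\<in>{1..d}. integral {0..upar P} (\<lambda>a. \<bar>q j\<bar>\<^sup>2 * norm (Ssum d P (q j) a) ^ 4))"
    using int by (intro integral_sum) auto
  also have "\<dots> \<le> (\<Sum>j\<in>{1..d}. fourth_moment_const d * upar P * qm * P\<^sup>2 * ln P)"
  proof (rule sum_mono)
    fix j assume j: "j \<in> {1..d}"
    have "integral {0..upar P} (\<lambda>a. \<bar>q j\<bar>\<^sup>2 * norm (Ssum d P (q j) a) ^ 4)
        \<le> fourth_moment_const d * upar P * \<bar>q j\<bar> * P\<^sup>2 * ln P"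
      using q[OF j] by (rule integral_Ssum_power4_le[OF d _ P u])
    also have "\<dots> \<le> fourth_moment_const d * upar P * qm * P\<^sup>2 * ln P"
      using qm[OF j] fourth_moment_const_nonneg[OF d] \<open>0 \<le> ln P\<close>
      by (intro mult_right_mono mult_left_mono) (auto simp: upar_def)
    finally show "integral {0..upar P} (\<lambda>a. \<bar>q j\<bar>\<^sup>2 * norm (Ssum d P (q j) a) ^ 4)
        \<le> fourth_moment_const d * upar P * qm * P\<^sup>2 * ln P" .
  qed
  finally show "integral {0..upar P} (\<lambda>a. \<Sum>j\<in>{1..d}. \<bar>q j\<bar>\<^sup>2 * norm (Ssum d P (q j) a) ^ 4)
      \<le> real d * (fourth_moment_const d * upar P * qm * P\<^sup>2 * ln P)" by simp
qed

section \<open>The product of the sums S_j off F\<close>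

lemma lift_Suc_mono_le_on:
  fixes f :: "nat \<Rightarrow> 'a::order"
  assumes step: "\<And>i. i \<in> {1..<n} \<Longrightarrow> f i \<le> f (i + 1)" and "1 \<le> k" "k \<le> l" "l \<le> n"
  shows "f k \<le> f l"
  using assms(3,4)
proof (induction l rule: dec_induct)
  case (step j)
  then have "f k \<le> f j" by simp
  also have "f j \<le> f (j + 1)" using step.hyps step.prems assms(2) by (intro assms(1)) auto
  finally show ?case by simp
qed simp

lemma prod_le_of_sorted:
  fixes A :: "nat \<Rightarrow> real"
  assumes perm: "p permutes {1..n}"
    and nonneg: "\<And>j. j \<in> {1..n} \<Longrightarrow> 0 \<le> A j" and bound: "\<And>j. j \<in> {1..n} \<Longrightarrow> A j \<le> B"
    and sorted: "\<And>i. i \<in> {1..<n} \<Longrightarrow> A (p i) \<le> A (p (i + 1))"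
    and m: "1 \<le> m" "m \<le> i" "i \<le> n" "m + 4 \<le> n" and small: "A (p i) \<le> T"
  shows "(\<Prod>j\<in>{1..n}. A j) \<le> T ^ m * B ^ (n - 4 - m) * (\<Sum>j\<in>{1..n}. A j ^ 4)"
proof -
  have p: "p k \<in> {1..n}" if "k \<in> {1..n}" for k using permutes_in_image[OF perm] that by blast
  have mono: "A (p k) \<le> A (p l)" if "1 \<le> k" "k \<le> l" "l \<le> n" for k l
    using lift_Suc_mono_le_on[of n "A \<circ> p", OF _ that] sorted by simp
  define b where "b k = (if k \<le> m then T else if k \<le> n - 4 then B else A (p n))" for k
  have "(\<Prod>j\<in>{1..n}. A j) = (\<Prod>k\<in>{1..n}. A (p k))"
    using prod.permute[OF perm, of A] by (simp add: comp_def)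
  also have "\<dots> \<le> (\<Prod>k\<in>{1..n}. b k)"
  proof (rule prod_mono)
    fix k assume k: "k \<in> {1..n}"
    have "A (p k) \<le> b k"
      using mono[of k i] mono[of k n] small bound[OF p[OF k]] k m by (auto simp: b_def)
    then show "0 \<le> A (p k) \<and> A (p k) \<le> b k" using nonneg[OF p[OF k]] by simp
  qed
  also have "(\<Prod>k\<in>{1..n}. b k) = (\<Prod>k\<in>{1..m}. b k) * (\<Prod>k\<in>{m+1..n-4}. b k) * (\<Prod>k\<in>{n-3..n}. b k)"
  proof -
    have "{1..n} = {1..n-4} \<union> {n-3..n}" using m by auto
    then have "(\<Prod>k\<in>{1..n}. b k) = (\<Prod>k\<in>{1..n-4}. b k) * (\<Prod>k\<in>{n-3..n}. b k)"
      by (simp only:) (rule prod.union_disjoint, auto)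
    moreover have "{1..n-4} = {1..m} \<union> {m+1..n-4}" using m by auto
    then have "(\<Prod>k\<in>{1..n-4}. b k) = (\<Prod>k\<in>{1..m}. b k) * (\<Prod>k\<in>{m+1..n-4}. b k)"
      by (simp only:) (rule prod.union_disjoint, auto)
    ultimately show ?thesis by simp
  qed
  also have "\<dots> = T ^ m * B ^ (n - 4 - m) * A (p n) ^ 4"
  proof -
    have "(\<Prod>k\<in>{n-3..n}. b k) = (\<Prod>k\<in>{n-3..n}. A (p n))"
      using m by (intro prod.cong) (auto simp: b_def)
    then show ?thesis using m by (simp add: b_def)
  qed
  also have "\<dots> \<le> T ^ m * B ^ (n - 4 - m) * (\<Sum>j\<in>{1..n}. A j ^ 4)"
  proof (rule mult_left_mono)
    show "A (p n) ^ 4 \<le> (\<Sum>j\<in>{1..n}. A j ^ 4)"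
      using p[of n] m by (intro member_le_sum) auto
    have "0 \<le> A (p i)" "A (p n) \<le> B" using nonneg p bound m by auto
    then show "0 \<le> T ^ m * B ^ (n - 4 - m)" using small nonneg[OF p[of n]] m by simp
  qed
  finally show ?thesis .
qed

lemma norm_prod_eq_sqrt_weighted:
  fixes z :: "'i \<Rightarrow> complex" and w :: "'i \<Rightarrow> real"
  assumes "\<And>j. j \<in> I \<Longrightarrow> w j > 0"
  shows "norm (\<Prod>j\<in>I. z j) = (\<Prod>j\<in>I. w j) powr (- 1 / 2) * (\<Prod>j\<in>I. sqrt (w j) * norm (z j))"
proof -
  have "(\<Prod>j\<in>I. w j) powr (- 1 / 2) * (\<Prod>j\<in>I. sqrt (w j) * norm (z j))
      = (\<Prod>j\<in>I. w j powr (- 1 / 2) * sqrt (w j) * norm (z j))"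
    by (simp add: prod_powr_distrib prod.distrib mult.assoc)
  also have "\<dots> = (\<Prod>j\<in>I. norm (z j))"
  proof (rule prod.cong[OF refl])
    fix j assume "j \<in> I"
    then have "0 < w j" by (rule assms)
    then show "w j powr (- 1 / 2) * sqrt (w j) * norm (z j) = norm (z j)"
      by (simp add: powr_minus_divide powr_half_sqrt)
  qed
  finally show ?thesis by (simp add: prod_norm)
qed

lemma pointwise_prod_Ssum_le:
  fixes d :: nat and P Z a :: real and q :: "nat \<Rightarrow> real" and p :: "nat \<Rightarrow> nat"
  defines "A j \<equiv> sqrt \<bar>q j\<bar> * norm (Ssum d P (q j) a)"
  assumes d: "d \<ge> 5" and q: "\<And>j. j \<in> {1..d} \<Longrightarrow> 1 \<le> \<bar>q j\<bar>" and perm: "p permutes {1..d}"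
    and P: "P > 0" and Z: "Z > 0" and sorted: "\<And>i. i \<in> {1..<d} \<Longrightarrow> A (p i) \<le> A (p (i + 1))"
    and i: "i \<in> {1..d}" and small: "A (p i) \<le> P * Z powr (- 1 / real (min i (d - 4)))"
  shows "norm (\<Prod>j\<in>{1..d}. Ssum d P (q j) a) \<le> (\<Prod>j\<in>{1..d}. \<bar>q j\<bar>) powr (- 1 / 2)
    * ((2 * real d) ^ (d - 4) * P ^ (d - 4) / Z) * (\<Sum>j\<in>{1..d}. \<bar>q j\<bar>\<^sup>2 * norm (Ssum d P (q j) a) ^ 4)"
proof -
  define m where "m = min i (d - 4)"
  have m: "1 \<le> m" "m \<le> i" "i \<le> d" "m + 4 \<le> d" using i d by (auto simp: m_def)
  have A4: "A j ^ 4 = \<bar>q j\<bar>\<^sup>2 * norm (Ssum d P (q j) a) ^ 4" for j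
    using power_mult[of "sqrt \<bar>q j\<bar>" 2 2] by (simp add: A_def power_mult_distrib)
  have A_bounds: "0 \<le> A j" "A j \<le> 2 * real d * P" if "j \<in> {1..d}" for j
    using Ssum_trivial_bound[OF P q[OF that]] by (simp_all add: A_def)
  have "A (p i) \<le> P * Z powr (- 1 / real m)" using small by (simp add: m_def)
  from prod_le_of_sorted[OF perm A_bounds sorted m this]
  have "(\<Prod>j\<in>{1..d}. A j) \<le> (P * Z powr (- 1 / real m)) ^ m * (2 * real d * P) ^ (d - 4 - m)
      * (\<Sum>j\<in>{1..d}. A j ^ 4)" .
  also have "\<dots> \<le> (2 * real d) ^ (d - 4) * P ^ (d - 4) / Z * (\<Sum>j\<in>{1..d}. A j ^ 4)"
  proof (rule mult_right_mono)
    have "(Z powr (- 1 / real m)) ^ m = Z powr (- 1 / real m * real m)"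
      using Z by (simp add: powr_realpow[symmetric] powr_powr)
    also have "\<dots> = 1 / Z" using m Z by (simp add: powr_minus divide_inverse)
    finally have "(P * Z powr (- 1 / real m)) ^ m * (2 * real d * P) ^ (d - 4 - m)
        = (2 * real d) ^ (d - 4 - m) * (P ^ m * P ^ (d - 4 - m)) / Z"
      by (simp add: power_mult_distrib)
    also have "\<dots> = (2 * real d) ^ (d - 4 - m) * P ^ (d - 4) / Z" using m by (simp flip: power_add)
    also have "\<dots> \<le> (2 * real d) ^ (d - 4) * P ^ (d - 4) / Z"
      using d P Z by (intro divide_right_mono mult_right_mono power_increasing) auto
    finally show "(P * Z powr (- 1 / real m)) ^ m * (2 * real d * P) ^ (d - 4 - m)
        \<le> (2 * real d) ^ (d - 4) * P ^ (d - 4) / Z" .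
  qed (simp add: sum_nonneg)
  finally have prod_A: "(\<Prod>j\<in>{1..d}. A j) \<le> (2 * real d) ^ (d - 4) * P ^ (d - 4) / Z * (\<Sum>j\<in>{1..d}. A j ^ 4)" .
  have "norm (\<Prod>j\<in>{1..d}. Ssum d P (q j) a) = (\<Prod>j\<in>{1..d}. \<bar>q j\<bar>) powr (- 1 / 2) * (\<Prod>j\<in>{1..d}. A j)"
    unfolding A_def using q by (intro norm_prod_eq_sqrt_weighted) fastforce
  also have "\<dots> \<le> (\<Prod>j\<in>{1..d}. \<bar>q j\<bar>) powr (- 1 / 2) * ((2 * real d) ^ (d - 4) * P ^ (d - 4) / Z * (\<Sum>j\<in>{1..d}. A j ^ 4))"
    using prod_A by (rule mult_left_mono) simp
  finally show ?thesis by (simp add: A4 mult.assoc)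
qed

(* No integrability of f on E is assumed: otherwise integral E f = 0. *)
lemma integral_le_integral_superset:
  fixes f g :: "'a::euclidean_space \<Rightarrow> real"
  assumes "E \<subseteq> S" and g: "g integrable_on S"
    and le: "\<And>x. x \<in> E \<Longrightarrow> f x \<le> g x" and g_nonneg: "\<And>x. x \<in> S \<Longrightarrow> 0 \<le> g x"
  shows "integral E f \<le> integral S g"
proof (cases "f integrable_on E")
  case True
  have "integral E f = integral UNIV (\<lambda>x. if x \<in> E then f x else 0)"
    by (simp add: integral_restrict_UNIV)
  also have "\<dots> \<le> integral UNIV (\<lambda>x. if x \<in> S then g x else 0)"
    using True g assms(1) le g_nonneg by (intro integral_le) (auto simp: integrable_restrict_UNIV)
  also have "\<dots> = integral S g" by (simp add: integral_restrict_UNIV)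
  finally show ?thesis .
next
  case False
  then show ?thesis using g g_nonneg by (simp add: not_integrable_integral integral_nonneg)
qed

lemma integral_prod_Ssum_le:
  fixes d :: nat and P qm :: real and q :: "nat \<Rightarrow> real" and p :: "nat \<Rightarrow> nat" and E :: "real set"
  defines "A j a \<equiv> sqrt \<bar>q j\<bar> * norm (Ssum d P (q j) a)"
  assumes d: "d \<ge> 5" and q: "\<And>j. j \<in> {1..d} \<Longrightarrow> 1 \<le> \<bar>q j\<bar>" and qm: "\<And>j. j \<in> {1..d} \<Longrightarrow> \<bar>q j\<bar> \<le> qm"
    and perm: "p permutes {1..d}" and P: "exp 1 \<le> P" and u: "(ln P)\<^sup>2 \<le> upar P"
    and E: "\<And>a. a \<in> E \<Longrightarrow> 0 \<le> a \<and> a \<le> upar P \<and> (\<forall>i\<in>{1..<d}. A (p i) a \<le> A (p (i + 1)) a)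
      \<and> (\<exists>i\<in>{1..d}. A (p i) a \<le> P * ((upar P)\<^sup>2 * qm) powr (- 1 / real (min i (d - 4))))"
  shows "integral E (\<lambda>a. norm (\<Prod>j\<in>{1..d}. Ssum d P (q j) a))
    \<le> (2 * real d) ^ (d - 4) * real d * fourth_moment_const d * (\<Prod>j\<in>{1..d}. \<bar>q j\<bar>) powr (- 1 / 2)
       * P ^ (d - 2) / ln P"
proof -
  define u l Z w where "u = upar P" and "l = ln P" and "Z = u\<^sup>2 * qm"
    and "w = (\<Prod>j\<in>{1..d}. \<bar>q j\<bar>) powr (- 1 / 2)"
  define c where "c = w * ((2 * real d) ^ (d - 4) * P ^ (d - 4) / Z)"
  define G where "G a = (\<Sum>j\<in>{1..d}. \<bar>q j\<bar>\<^sup>2 * norm (Ssum d P (q j) a) ^ 4)" for a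
  have d1: "d \<ge> 1" using d by simp
  note P0 = exp_one_leD(1)[OF P]
  have l1: "1 \<le> l" unfolding l_def by (rule exp_one_leD(2)[OF P])
  have lu: "l * l \<le> u" using u by (simp add: u_def l_def power2_eq_square)
  have qm1: "1 \<le> qm" using q[of 1] qm[of 1] d by simp
  have u0: "0 < u" using lu l1 by (smt (verit) mult_le_cancel_left1)
  have Z0: "0 < Z" using u0 qm1 by (simp add: Z_def)
  have c0: "0 \<le> c" using P0 Z0 by (simp add: c_def w_def)
  have G: "G integrable_on {0..u}" "integral {0..u} G \<le> real d * (fourth_moment_const d * u * qm * P\<^sup>2 * l)"
    using integral_sum_Ssum_power4_le[OF d1 q qm P u] unfolding G_def u_def l_def by auto
  have "integral E (\<lambda>a. norm (\<Prod>j\<in>{1..d}. Ssum d P (q j) a)) \<le> integral {0..u} (\<lambda>a. c * G a)"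
  proof (rule integral_le_integral_superset)
    show "E \<subseteq> {0..u}" using E by (auto simp: u_def)
    show "(\<lambda>a. c * G a) integrable_on {0..u}" using G(1) by (rule integrable_on_mult_right)
    show "0 \<le> c * G a" for a using c0 by (simp add: G_def sum_nonneg)
    fix a assume "a \<in> E"
    then obtain i where "\<forall>i\<in>{1..<d}. A (p i) a \<le> A (p (i + 1)) a" "i \<in> {1..d}"
      "A (p i) a \<le> P * Z powr (- 1 / real (min i (d - 4)))"
      using E unfolding Z_def u_def by blast
    then show "norm (\<Prod>j\<in>{1..d}. Ssum d P (q j) a) \<le> c * G a"
      unfolding A_def c_def G_def w_def
      by (intro pointwise_prod_Ssum_le[OF d q perm P0 Z0]) auto
  qed
  also have "\<dots> \<le> c * (real d * (fourth_moment_const d * u * qm * P\<^sup>2 * l))"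
    using G(2) c0 by (simp add: mult_left_mono)
  also have "\<dots> = (2 * real d) ^ (d - 4) * real d * fourth_moment_const d * w * P ^ (d - 2) * (l / u)"
  proof -
    have "d - 4 + 2 = d - 2" using d by simp
    then have "P ^ (d - 4) * P\<^sup>2 = P ^ (d - 2)" by (metis power_add)
    then show ?thesis using u0 qm1 by (simp add: c_def Z_def field_simps power2_eq_square)
  qed
  also have "\<dots> \<le> (2 * real d) ^ (d - 4) * real d * fourth_moment_const d * w * P ^ (d - 2) * (1 / l)"
    using lu l1 u0 P0 fourth_moment_const_nonneg[OF d1]
    by (intro mult_left_mono) (simp_all add: field_simps w_def)
  finally show ?thesis by (simp add: w_def l_def)
qed

lemma card_pos_add_card_neg:
  fixes q :: "'a \<Rightarrow> real"
  assumes "finite I" and "\<And>i. i \<in> I \<Longrightarrow> q i \<noteq> 0"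
  shows "card {i\<in>I. q i > 0} + card {i\<in>I. q i < 0} = card I"
proof -
  have "{i\<in>I. q i > 0} \<union> {i\<in>I. q i < 0} = I" using assms(2) by (auto simp: neq_iff)
  moreover have "card ({i\<in>I. q i > 0} \<union> {i\<in>I. q i < 0}) = card {i\<in>I. q i > 0} + card {i\<in>I. q i < 0}"
    using assms(1) by (intro card_Un_disjoint) auto
  ultimately show ?thesis by simp
qed

lemma betapar_nonneg:
  assumes "r \<ge> 1" and "s \<ge> 1" and "r + s \<ge> 5"
  shows "betapar r s \<ge> 0"
  using assms unfolding betapar_def Let_def by (auto simp: max_def min_def)

lemma exp_one_le_sqrt:
  assumes "exp (exp 1) \<le> x"
  shows "exp 1 \<le> sqrt x"
proof (rule real_le_rsqrt)
  have "(exp 1)\<^sup>2 = exp (2::real)" by (simp add: power2_eq_square flip: exp_add)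
  also have "\<dots> \<le> exp (exp 1)" using exp_ge_add_one_self[of 1] by simp
  finally show "(exp 1)\<^sup>2 \<le> x" using assms by linarith
qed

lemma sqrt_le_Hpar:
  assumes "Cd \<ge> 1" and "qm \<ge> 1" and "\<beta> \<ge> 0"
  shows "sqrt qm \<le> Hpar Cd qm \<beta>"
proof -
  have "sqrt qm = qm powr (1 / 2)" using assms(2) by (simp add: powr_half_sqrt)
  also have "\<dots> \<le> qm powr (1 / 2 + \<beta>)" using assms(2,3) by (intro powr_mono) auto
  also have "\<dots> \<le> Cd * qm powr (1 / 2 + \<beta>)" using assms(1) by (simp add: mult_le_cancel_right1)
  finally show ?thesis unfolding Hpar_def .
qed

lemma le_Ppar:
  assumes "exp 1 \<le> H"
  shows "H \<le> Ppar d H"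
proof -
  note H = exp_one_leD(1)[OF assms] and lH = exp_one_leD(2)[OF assms]
  then have "0 \<le> 10 * (real d)\<^sup>2 / ln (ln H)" by simp
  then have "ln H \<le> (1 + 10 * (real d)\<^sup>2 / ln (ln H)) * ln H" using lH by (simp add: algebra_simps)
  then show ?thesis unfolding Ppar_def using H by (metis exp_le_cancel_iff exp_ln)
qed

lemma exp_one_le_Ppar_Hpar:
  assumes "Cd \<ge> 1" and "exp (exp 1) \<le> qm" and "\<beta> \<ge> 0"
  shows "exp 1 \<le> Ppar d (Hpar Cd qm \<beta>)"
proof -
  have "1 \<le> qm" using assms(2) by (smt (verit) one_le_exp_iff exp_ge_zero)
  with assms(1,3) have "sqrt qm \<le> Hpar Cd qm \<beta>" by (intro sqrt_le_Hpar)
  then have "exp 1 \<le> Hpar Cd qm \<beta>" using exp_one_le_sqrt[OF assms(2)] by linarith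
  then show ?thesis using le_Ppar order_trans by blast
qed

lemma ln_square_le_upar:
  assumes "P \<ge> 1"
  shows "(ln P)\<^sup>2 \<le> upar P"
  unfolding upar_def using assms by (intro power_mono ln_mono) auto

theorem lemma2p10:
  fixes d :: nat and Cd :: real
  assumes "d \<ge> 5" and "Cd \<ge> 1"
  shows "\<exists>C::real. \<forall>(q::nat \<Rightarrow> real) (\<pi>::nat \<Rightarrow> nat).
    (\<forall>i\<in>{1..d}. \<bar>q i\<bar> \<ge> exp (exp 1)) \<and>
    card {i\<in>{1..d}. q i > 0} \<ge> 1 \<and> card {i\<in>{1..d}. q i < 0} \<ge> 1 \<and>
    \<pi> permutes {1..d} \<longrightarrow>
    (let r = card {i\<in>{1..d}. q i > 0};
         s = card {i\<in>{1..d}. q i < 0};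
         q0 = Min ((\<lambda>j. \<bar>q j\<bar>) ` {1..d});
         qm = Max ((\<lambda>j. \<bar>q j\<bar>) ` {1..d});
         Q = (\<Prod>j\<in>{1..d}. \<bar>q j\<bar>);
         P = Ppar d (Hpar Cd qm (betapar r s));
         S = (\<lambda>j \<alpha>. Ssum d P (q j) \<alpha>);
         A = (\<lambda>j \<alpha>. sqrt \<bar>q j\<bar> * norm (S j \<alpha>));
         J = {\<alpha>::real. 0 < \<alpha> \<and> 1 / (8 * real d * P * sqrt q0) < \<alpha> \<and> \<alpha> < upar P};
         J\<pi> = {\<alpha>\<in>J. \<forall>i\<in>{1..<d}. A (\<pi> i) \<alpha> \<le> A (\<pi> (i + 1)) \<alpha>};
         F = {\<alpha>\<in>J\<pi>. \<forall>i\<in>{1..d}.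
                A (\<pi> i) \<alpha> > P * ((upar P)\<^sup>2 * qm) powr (- 1 / real (min i (d - 4)))}
     in integral (J\<pi> - F) (\<lambda>\<alpha>. norm (\<Prod>j\<in>{1..d}. S j \<alpha>))
          \<le> C * Q powr (- 1 / 2) * P ^ (d - 2) / ln P)"
  apply (intro exI[of _ "(2 * real d) ^ (d - 4) * real d * fourth_moment_const d"] allI impI)
  \<comment> \<open>Only \<open>J\<pi> - F \<subseteq> [0, u(P)]\<close> is used.\<close>
  subgoal premises hyps for q \<pi>
  proof -
    have q: "\<And>j. j \<in> {1..d} \<Longrightarrow> exp (exp 1) \<le> \<bar>q j\<bar>"
      and r: "card {i\<in>{1..d}. q i > 0} \<ge> 1" and s: "card {i\<in>{1..d}. q i < 0} \<ge> 1"
      and perm: "\<pi> permutes {1..d}" using hyps by blast+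
    define qm where "qm = Max ((\<lambda>j. \<bar>q j\<bar>) ` {1..d})"
    define \<beta> where "\<beta> = betapar (card {i\<in>{1..d}. q i > 0}) (card {i\<in>{1..d}. q i < 0})"
    define P where "P = Ppar d (Hpar Cd qm \<beta>)"
    have q1: "\<And>j. j \<in> {1..d} \<Longrightarrow> 1 \<le> \<bar>q j\<bar>" using q by (smt (verit) one_le_exp_iff exp_ge_zero)
    have qm: "\<And>j. j \<in> {1..d} \<Longrightarrow> \<bar>q j\<bar> \<le> qm" unfolding qm_def by simp
    have "card {i\<in>{1..d}. q i > 0} + card {i\<in>{1..d}. q i < 0} = d"
      using card_pos_add_card_neg[of "{1..d}" q] q1 by fastforce
    then have "\<beta> \<ge> 0" unfolding \<beta>_def using r s assms(1) by (intro betapar_nonneg) simp_all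
    moreover have "exp (exp 1) \<le> qm" using q[of 1] qm[of 1] assms(1) by simp
    ultimately have P: "exp 1 \<le> P" unfolding P_def by (intro exp_one_le_Ppar_Hpar assms(2))
    then have u: "(ln P)\<^sup>2 \<le> upar P" by (intro ln_square_le_upar) (simp add: order_trans[OF _ P])
    show ?thesis
      unfolding Let_def qm_def[symmetric] \<beta>_def[symmetric] P_def[symmetric]
      by (intro integral_prod_Ssum_le[OF assms(1) q1 qm perm P u]) (auto simp: not_less)
  qed
  done

end
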